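(* Let $\mathcal{C}=(\mathcal{C},\otimes,I)$ and $\mathcal{D}=(\mathcal{D},\odot,J)$ be additive strict monoidal categories and let $(F,\Psi):\mathcal{C}\to\mathcal{D}$ be an additive (non-unital) strong monoidal functor. If $(L,\lambda,[-,-])$ is a YB-Lie algebra in $\mathcal{C}$, then $$\bigl(FL,\ \Psi_{L,L}^{-1}\circ F(\lambda)\circ\Psi_{L,L},\ F([-,-])\circ\Psi_{L,L}\bigr)$$ is a YB-Lie algebra in $\mathcal{D}$.
   Context: An object also denotes its identity morphism; $0_{X,Y}$ denotes the zero morphism $X\to Y$. A non-unital monoidal functor $(F,\Psi):\mathcal{C}\to\mathcal{D}$ between strict monoidal categories is a functor $F:\mathcal{C}\to\mathcal{D}$ together with a natural transformation $\Psi_{X,Y}:FX\odot FY\to F(X\otimes Y)$ satisfying, for all objects $X,Y,Z$ of $\mathcal{C}$, $$\Psi_{X\otimes Y,Z}\circ(\Psi_{X,Y}\odot FZ)=\Psi_{X,Y\otimes Z}\circ(FX\odot\Psi_{Y,Z}).$$ It is strong if every $\Psi_{X,Y}$ is invertible, and additive if the functor $F$ is additive. No condition on the unit objects is required. A self-invertible Yang-Baxter operator on an object $L$ of a strict monoidal category $(\mathcal{C},\otimes,I)$ is a morphism $\lambda:L\otimes L\to L\otimes L$ with $\lambda\circ\lambda=\mathrm{id}_{L\otimes L}$ and $$(\lambda\otimes L)\circ(L\otimes\lambda)\circ(\lambda\otimes L)=(L\otimes\lambda)\circ(\lambda\otimes L)\circ(L\otimes\lambda).$$ Put $t_\lambda=(\lambda\otimes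 L)\circ(L\otimes\lambda)$ and $w_\lambda=(L\otimes\lambda)\circ(\lambda\otimes L)$. A YB-Lie algebra in an additive strict monoidal category $\mathcal{C}$ is a triple $(L,\lambda,[-,-])$ where $L$ is an object of $\mathcal{C}$, $\lambda$ is a self-invertible Yang-Baxter operator on $L$, and $[-,-]:L\otimes L\to L$ is a morphism in $\mathcal{C}$ satisfying (i) $[-,-]\circ(\mathrm{id}_{L\otimes L}+\lambda)=0_{L\otimes L,L}$; (ii) $[-,-]\circ(\mathrm{id}_L\otimes[-,-])\circ(\mathrm{id}_{L\otimes L\otimes L}+t_\lambda+w_\lambda)=0_{L\otimes L\otimes L,L}$; (iii) $(\mathrm{id}_L\otimes[-,-])\circ t_\lambda=\lambda\circ([-,-]\otimes \mathrm{id}_L)$. *)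

theory Defs
  imports "HOL-Algebra.Group"
begin

section \<open>Categories, strict monoidal categories, additive categories\<close>

text \<open>
  Arrows carry their domain and codomain; composition, tensor product and addition are
  total functions that are only constrained on composable, arbitrary, and parallel arrows of
  the category, respectively.  The arrow \<open>g \<cdot> f\<close> is \<open>g\<close> after \<open>f\<close>.
\<close>

record ('o, 'a) cat =
  Obj :: "'o set"
  Arr :: "'a set"
  Dom :: "'a \<Rightarrow> 'o"
  Cod :: "'a \<Rightarrow> 'o"
  Id :: "'o \<Rightarrow> 'a"
  Comp :: "'a \<Rightarrow> 'a \<Rightarrow> 'a"  (infixl \<open>\<cdot>\<index>\<close> 70)

record ('o, 'a) moncat = "('o, 'a) cat" +
  Tensor_obj :: "'o \<Rightarrow> 'o \<Rightarrow> 'o"  (infixl \<open>\<odot>\<index>\<close> 75)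
  Tensor_arr :: "'a \<Rightarrow> 'a \<Rightarrow> 'a"  (infixl \<open>\<star>\<index>\<close> 75)
  Unit_obj :: "'o"

record ('o, 'a) addmoncat = "('o, 'a) moncat" +
  Add :: "'a \<Rightarrow> 'a \<Rightarrow> 'a"  (infixl \<open>\<oplus>\<index>\<close> 65)
  Zero :: "'o \<Rightarrow> 'o \<Rightarrow> 'a"

definition Hom :: "('o, 'a, 'm) cat_scheme \<Rightarrow> 'o \<Rightarrow> 'o \<Rightarrow> 'a set" where
  "Hom C X Y = {f \<in> Arr C. Dom C f = X \<and> Cod C f = Y}"

locale category =
  fixes C :: "('o, 'a, 'm) cat_scheme" (structure)
  assumes Dom_Obj: "f \<in> Arr C \<Longrightarrow> Dom C f \<in> Obj C"
    and Cod_Obj: "f \<in> Arr C \<Longrightarrow> Cod C f \<in> Obj C"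
    and Id_Hom: "X \<in> Obj C \<Longrightarrow> Id C X \<in> Hom C X X"
    and Comp_Hom: "f \<in> Hom C X Y \<Longrightarrow> g \<in> Hom C Y Z \<Longrightarrow> g \<cdot> f \<in> Hom C X Z"
    and Comp_Id: "f \<in> Hom C X Y \<Longrightarrow> f \<cdot> Id C X = f"
    and Id_Comp: "f \<in> Hom C X Y \<Longrightarrow> Id C Y \<cdot> f = f"
    and Comp_assoc: "f \<in> Hom C W X \<Longrightarrow> g \<in> Hom C X Y \<Longrightarrow> h \<in> Hom C Y Z \<Longrightarrow>
      (h \<cdot> g) \<cdot> f = h \<cdot> (g \<cdot> f)"

definition is_inverse :: "('o, 'a, 'm) cat_scheme \<Rightarrow> 'a \<Rightarrow> 'a \<Rightarrow> bool" where
  "is_inverse C f g \<longleftrightarrow> g \<in> Hom C (Cod C f) (Dom C f) \<and>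
     g \<cdot>\<^bsub>C\<^esub> f = Id C (Dom C f) \<and> f \<cdot>\<^bsub>C\<^esub> g = Id C (Cod C f)"

definition invertible :: "('o, 'a, 'm) cat_scheme \<Rightarrow> 'a \<Rightarrow> bool" where
  "invertible C f \<longleftrightarrow> f \<in> Arr C \<and> (\<exists>g. is_inverse C f g)"

definition Inv :: "('o, 'a, 'm) cat_scheme \<Rightarrow> 'a \<Rightarrow> 'a" where
  "Inv C f = (THE g. is_inverse C f g)"

locale strict_monoidal_category = category C
  for C :: "('o, 'a, 'm) moncat_scheme" (structure) +
  assumes Unit_Obj: "Unit_obj C \<in> Obj C"
    and Tensor_Obj: "X \<in> Obj C \<Longrightarrow> Y \<in> Obj C \<Longrightarrow> X \<odot> Y \<in> Obj C"
    and Tensor_Hom: "f \<in> Hom C X X' \<Longrightarrow> g \<in> Hom C Y Y' \<Longrightarrow>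
      f \<star> g \<in> Hom C (X \<odot> Y) (X' \<odot> Y')"
    and Tensor_Id: "X \<in> Obj C \<Longrightarrow> Y \<in> Obj C \<Longrightarrow> Id C X \<star> Id C Y = Id C (X \<odot> Y)"
    and Tensor_Comp: "f \<in> Hom C X X' \<Longrightarrow> f' \<in> Hom C X' X'' \<Longrightarrow>
      g \<in> Hom C Y Y' \<Longrightarrow> g' \<in> Hom C Y' Y'' \<Longrightarrow>
      (f' \<cdot> f) \<star> (g' \<cdot> g) = (f' \<star> g') \<cdot> (f \<star> g)"
    and Tensor_obj_assoc: "X \<in> Obj C \<Longrightarrow> Y \<in> Obj C \<Longrightarrow> Z \<in> Obj C \<Longrightarrow>
      (X \<odot> Y) \<odot> Z = X \<odot> (Y \<odot> Z)"
    and Tensor_arr_assoc: "f \<in> Arr C \<Longrightarrow> g \<in> Arr C \<Longrightarrow> h \<in> Arr C \<Longrightarrow>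
      (f \<star> g) \<star> h = f \<star> (g \<star> h)"
    and Unit_Tensor_obj: "X \<in> Obj C \<Longrightarrow> Unit_obj C \<odot> X = X"
    and Tensor_Unit_obj: "X \<in> Obj C \<Longrightarrow> X \<odot> Unit_obj C = X"
    and Unit_Tensor_arr: "f \<in> Arr C \<Longrightarrow> Id C (Unit_obj C) \<star> f = f"
    and Tensor_Unit_arr: "f \<in> Arr C \<Longrightarrow> f \<star> Id C (Unit_obj C) = f"

locale additive_category = category C
  for C :: "('o, 'a, 'm) addmoncat_scheme" (structure) +
  assumes Hom_group: "X \<in> Obj C \<Longrightarrow> Y \<in> Obj C \<Longrightarrow>
      comm_group \<lparr>carrier = Hom C X Y, mult = Add C, one = Zero C X Y\<rparr>"
    and Comp_Add: "f \<in> Hom C X Y \<Longrightarrow> g \<in> Hom C Y Z \<Longrightarrow> g' \<in> Hom C Y Z \<Longrightarrow>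
      (g \<oplus> g') \<cdot> f = (g \<cdot> f) \<oplus> (g' \<cdot> f)"
    and Add_Comp: "f \<in> Hom C X Y \<Longrightarrow> f' \<in> Hom C X Y \<Longrightarrow> g \<in> Hom C Y Z \<Longrightarrow>
      g \<cdot> (f \<oplus> f') = (g \<cdot> f) \<oplus> (g \<cdot> f')"
    and zero_object: "\<exists>N \<in> Obj C. \<forall>X \<in> Obj C. (\<exists>!f. f \<in> Hom C N X) \<and> (\<exists>!f. f \<in> Hom C X N)"
    and biproducts: "X \<in> Obj C \<Longrightarrow> Y \<in> Obj C \<Longrightarrow>
      \<exists>B \<in> Obj C. \<exists>i \<in> Hom C X B. \<exists>j \<in> Hom C Y B. \<exists>p \<in> Hom C B X. \<exists>q \<in> Hom C B Y.
        p \<cdot> i = Id C X \<and> q \<cdot> j = Id C Y \<and> q \<cdot> i = Zero C X Y \<and> p \<cdot> j = Zero C Y X \<and>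
        (i \<cdot> p) \<oplus> (j \<cdot> q) = Id C B"

text \<open>
  Biadditivity of the tensor product is not required here; a category in which it does hold is
  a special case.
\<close>

locale additive_strict_monoidal_category =
  strict_monoidal_category C + additive_category C
  for C :: "('o, 'a, 'm) addmoncat_scheme" (structure)


section \<open>Non-unital monoidal functors\<close>

locale cat_functor = C: category C + D: category D
  for C :: "('o, 'a, 'm) cat_scheme" and D :: "('p, 'b, 'n) cat_scheme" +
  fixes Fo :: "'o \<Rightarrow> 'p" and Fa :: "'a \<Rightarrow> 'b"
  assumes functor_Obj: "X \<in> Obj C \<Longrightarrow> Fo X \<in> Obj D"
    and functor_Hom: "f \<in> Hom C X Y \<Longrightarrow> Fa f \<in> Hom D (Fo X) (Fo Y)"
    and functor_Id: "X \<in> Obj C \<Longrightarrow> Fa (Id C X) = Id D (Fo X)"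
    and functor_Comp: "f \<in> Hom C X Y \<Longrightarrow> g \<in> Hom C Y Z \<Longrightarrow>
      Fa (g \<cdot>\<^bsub>C\<^esub> f) = Fa g \<cdot>\<^bsub>D\<^esub> Fa f"

locale nonunital_monoidal_functor =
  C: strict_monoidal_category C + D: strict_monoidal_category D + cat_functor C D Fo Fa
  for C :: "('o, 'a, 'm) moncat_scheme" and D :: "('p, 'b, 'n) moncat_scheme"
    and Fo :: "'o \<Rightarrow> 'p" and Fa :: "'a \<Rightarrow> 'b" +
  fixes \<Psi> :: "'o \<Rightarrow> 'o \<Rightarrow> 'b"
  assumes Psi_Hom: "X \<in> Obj C \<Longrightarrow> Y \<in> Obj C \<Longrightarrow>
      \<Psi> X Y \<in> Hom D (Fo X \<odot>\<^bsub>D\<^esub> Fo Y) (Fo (X \<odot>\<^bsub>C\<^esub> Y))"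
    and Psi_natural: "f \<in> Hom C X X' \<Longrightarrow> g \<in> Hom C Y Y' \<Longrightarrow>
      \<Psi> X' Y' \<cdot>\<^bsub>D\<^esub> (Fa f \<star>\<^bsub>D\<^esub> Fa g) = Fa (f \<star>\<^bsub>C\<^esub> g) \<cdot>\<^bsub>D\<^esub> \<Psi> X Y"
    and Psi_assoc: "X \<in> Obj C \<Longrightarrow> Y \<in> Obj C \<Longrightarrow> Z \<in> Obj C \<Longrightarrow>
      \<Psi> (X \<odot>\<^bsub>C\<^esub> Y) Z \<cdot>\<^bsub>D\<^esub> (\<Psi> X Y \<star>\<^bsub>D\<^esub> Id D (Fo Z)) =
      \<Psi> X (Y \<odot>\<^bsub>C\<^esub> Z) \<cdot>\<^bsub>D\<^esub> (Id D (Fo X) \<star>\<^bsub>D\<^esub> \<Psi> Y Z)"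

locale strong_nonunital_monoidal_functor = nonunital_monoidal_functor +
  assumes Psi_invertible: "X \<in> Obj C \<Longrightarrow> Y \<in> Obj C \<Longrightarrow> invertible D (\<Psi> X Y)"

locale additive_functor =
  C: additive_category C + D: additive_category D + cat_functor C D Fo Fa
  for C :: "('o, 'a, 'm) addmoncat_scheme" and D :: "('p, 'b, 'n) addmoncat_scheme"
    and Fo :: "'o \<Rightarrow> 'p" and Fa :: "'a \<Rightarrow> 'b" +
  assumes functor_Add: "f \<in> Hom C X Y \<Longrightarrow> g \<in> Hom C X Y \<Longrightarrow>
      Fa (f \<oplus>\<^bsub>C\<^esub> g) = Fa f \<oplus>\<^bsub>D\<^esub> Fa g"


section \<open>YB-Lie algebras\<close>

definition YB_t :: "('o, 'a, 'm) moncat_scheme \<Rightarrow> 'o \<Rightarrow> 'a \<Rightarrow> 'a" where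
  "YB_t C L l = (l \<star>\<^bsub>C\<^esub> Id C L) \<cdot>\<^bsub>C\<^esub> (Id C L \<star>\<^bsub>C\<^esub> l)"

definition YB_w :: "('o, 'a, 'm) moncat_scheme \<Rightarrow> 'o \<Rightarrow> 'a \<Rightarrow> 'a" where
  "YB_w C L l = (Id C L \<star>\<^bsub>C\<^esub> l) \<cdot>\<^bsub>C\<^esub> (l \<star>\<^bsub>C\<^esub> Id C L)"

locale self_invertible_YB_operator = strict_monoidal_category C
  for C :: "('o, 'a, 'm) moncat_scheme" (structure) +
  fixes L :: 'o and l :: 'a
  assumes L_Obj: "L \<in> Obj C"
    and YB_Hom: "l \<in> Hom C (L \<odot> L) (L \<odot> L)"
    and YB_self_inverse: "l \<cdot> l = Id C (L \<odot> L)"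
    and YB_equation: "(l \<star> Id C L) \<cdot> (Id C L \<star> l) \<cdot> (l \<star> Id C L) =
      (Id C L \<star> l) \<cdot> (l \<star> Id C L) \<cdot> (Id C L \<star> l)"

locale YB_Lie_algebra =
  additive_strict_monoidal_category C + self_invertible_YB_operator C L l
  for C :: "('o, 'a, 'm) addmoncat_scheme" (structure) and L :: 'o and l :: 'a +
  fixes br :: 'a
  assumes bracket_Hom: "br \<in> Hom C (L \<odot> L) L"
    and antisymmetry: "br \<cdot> (Id C (L \<odot> L) \<oplus> l) = Zero C (L \<odot> L) L"
    and Jacobi: "br \<cdot> (Id C L \<star> br) \<cdot> (Id C (L \<odot> L \<odot> L) \<oplus> YB_t C L l \<oplus> YB_w C L l) =
      Zero C (L \<odot> L \<odot> L) L"
    and compatibility: "(Id C L \<star> br) \<cdot> YB_t C L l = l \<cdot> (br \<star> Id C L)"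

end

theory Submission
  imports Defs
begin

text \<open>
  Every axiom of a YB-Lie algebra is an equation between arrows built from \<open>\<lambda>\<close>, the bracket and
  identities by composition, tensor product and addition, with sources and targets among
  \<open>L\<close>, \<open>L \<otimes> L\<close> and \<open>L \<otimes> L \<otimes> L\<close>.  The objects \<open>FL\<close>, \<open>FL \<odot> FL\<close> and \<open>FL \<odot> FL \<odot> FL\<close> are identified
  with the images under \<open>F\<close> of these three by \<open>id\<close>, by \<open>\<Psi>\<close> and by the two-fold composite of
  \<open>\<Psi>\<close>; the associativity axiom of \<open>\<Psi>\<close> says that the two possible two-fold composites agree.

  Call any split monomorphism \<open>u : X' \<rightarrow> FX\<close> a frame; the three identifications are frames.  An
  arrow \<open>f' : X' \<rightarrow> Y'\<close> is said to represent \<open>f : X \<rightarrow> Y\<close> with respect to frames \<open>u\<close> and \<open>v\<close> if \<open>v \<cdot> f' = F f \<cdot> u\<close>.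
  Representation is compatible with identities, composition, addition, zero arrows and
  (by naturality of \<open>\<Psi>\<close>) tensor products, and since frames are monic an arrow has at most one
  representative (\<open>represents_unique\<close>).  The transported \<open>\<lambda>\<close> and bracket
  represent the original ones, essentially by definition.  Hence each side of an axiom in \<open>D\<close>
  represents the corresponding side of the axiom in \<open>C\<close>, and the axiom passes from \<open>C\<close> to \<open>D\<close>.
\<close>

section \<open>Inverses and zero arrows\<close>

context category
begin

lemma is_inverse_unique:
  assumes f: "f \<in> Arr C" and g: "is_inverse C f g" and h: "is_inverse C f h"
  shows "g = h"
proof -
  have fH: "f \<in> Hom C (Dom C f) (Cod C f)"
    using f by (simp add: Hom_def)
  have gH: "g \<in> Hom C (Cod C f) (Dom C f)" and gf: "g \<cdot> f = Id C (Dom C f)"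
    and hH: "h \<in> Hom C (Cod C f) (Dom C f)" and fh: "f \<cdot> h = Id C (Cod C f)"
    using g h by (auto simp: is_inverse_def)
  have "g = g \<cdot> (f \<cdot> h)"
    using Comp_Id[OF gH] fh by simp
  also have "\<dots> = h"
    using Comp_assoc[OF hH fH gH] Id_Comp[OF hH] gf by simp
  finally show ?thesis .
qed

lemma is_inverse_Inv:
  assumes "invertible C f"
  shows "is_inverse C f (Inv C f)"
proof -
  obtain g where f: "f \<in> Arr C" and g: "is_inverse C f g"
    using assms by (auto simp: invertible_def)
  show ?thesis
    unfolding Inv_def by (rule theI[of _ g]) (use g is_inverse_unique[OF f] in auto)
qed

end

context additive_category
begin

lemma Hom_Obj:
  assumes "f \<in> Hom C X Y"
  shows "X \<in> Obj C" "Y \<in> Obj C"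
  using assms Dom_Obj Cod_Obj by (auto simp: Hom_def)

lemma Add_Hom:
  assumes "f \<in> Hom C X Y" "g \<in> Hom C X Y"
  shows "f \<oplus> g \<in> Hom C X Y"
proof -
  interpret G: comm_group "\<lparr>carrier = Hom C X Y, mult = Add C, one = Zero C X Y\<rparr>"
    using Hom_group Hom_Obj[OF assms(1)] .
  show ?thesis using G.m_closed[of f g] assms by simp
qed

lemma Zero_Hom:
  assumes "X \<in> Obj C" "Y \<in> Obj C"
  shows "Zero C X Y \<in> Hom C X Y"
proof -
  interpret G: comm_group "\<lparr>carrier = Hom C X Y, mult = Add C, one = Zero C X Y\<rparr>"
    using Hom_group assms .
  show ?thesis using G.one_closed by simp
qed

lemma Zero_Add_Zero:
  assumes "X \<in> Obj C" "Y \<in> Obj C"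
  shows "Zero C X Y \<oplus> Zero C X Y = Zero C X Y"
proof -
  interpret G: comm_group "\<lparr>carrier = Hom C X Y, mult = Add C, one = Zero C X Y\<rparr>"
    using Hom_group assms .
  show ?thesis using G.l_one[of "Zero C X Y"] G.one_closed by simp
qed

text \<open>
  Used to see that composition and additive functors preserve zero arrows: an additive map
  takes \<open>0 + 0 = 0\<close> to an equation of the form \<open>f + f = f\<close>.
\<close>

lemma Zero_if_Add_self:
  assumes f: "f \<in> Hom C X Y" and ff: "f \<oplus> f = f"
  shows "f = Zero C X Y"
proof -
  interpret G: comm_group "\<lparr>carrier = Hom C X Y, mult = Add C, one = Zero C X Y\<rparr>"
    using Hom_group Hom_Obj[OF f] .
  show ?thesis using G.l_cancel_one[of f f] f ff by simp
qed

lemma Comp_Zero: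
  assumes g: "g \<in> Hom C Y Z" and X: "X \<in> Obj C"
  shows "g \<cdot> Zero C X Y = Zero C X Z"
proof -
  have z: "Zero C X Y \<in> Hom C X Y"
    using Zero_Hom X Hom_Obj(1)[OF g] .
  show ?thesis
    using Zero_if_Add_self[OF Comp_Hom[OF z g]] Add_Comp[OF z z g]
      Zero_Add_Zero[OF X Hom_Obj(1)[OF g]] by simp
qed

lemma Zero_Comp:
  assumes f: "f \<in> Hom C X Y" and Z: "Z \<in> Obj C"
  shows "Zero C Y Z \<cdot> f = Zero C X Z"
proof -
  have z: "Zero C Y Z \<in> Hom C Y Z"
    using Zero_Hom Hom_Obj(2)[OF f] Z .
  show ?thesis
    using Zero_if_Add_self[OF Comp_Hom[OF f z]] Comp_Add[OF f z z]
      Zero_Add_Zero[OF Hom_Obj(2)[OF f] Z] by simp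
qed

end

lemma (in additive_functor) functor_Zero:
  assumes "X \<in> Obj C" "Y \<in> Obj C"
  shows "Fa (Zero C X Y) = Zero D (Fo X) (Fo Y)"
proof -
  have z: "Zero C X Y \<in> Hom C X Y"
    using C.Zero_Hom assms .
  show ?thesis
    using D.Zero_if_Add_self[OF functor_Hom[OF z]] functor_Add[OF z z]
      C.Zero_Add_Zero[OF assms] by simp
qed

section \<open>Frames and represented arrows\<close>

datatype ('o, 'p, 'b) frame = Frame (base: 'o) (model: 'p) (comparison: 'b)

context cat_functor
begin

text \<open>
  A left inverse of the comparison arrow is what uniqueness of representatives rests on, and
  unlike plain monomorphy it is stable under tensor products.
\<close>

definition is_frame :: "('o, 'p, 'b) frame \<Rightarrow> bool" where
  "is_frame a \<longleftrightarrow> base a \<in> Obj C \<and> model a \<in> Obj D \<and>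
     comparison a \<in> Hom D (model a) (Fo (base a)) \<and>
     (\<exists>r \<in> Hom D (Fo (base a)) (model a). r \<cdot>\<^bsub>D\<^esub> comparison a = Id D (model a))"

definition represents ::
    "('o, 'p, 'b) frame \<Rightarrow> ('o, 'p, 'b) frame \<Rightarrow> 'b \<Rightarrow> 'a \<Rightarrow> bool" where
  "represents a b f' f \<longleftrightarrow> is_frame a \<and> is_frame b \<and>
     f \<in> Hom C (base a) (base b) \<and> f' \<in> Hom D (model a) (model b) \<and>
     comparison b \<cdot>\<^bsub>D\<^esub> f' = Fa f \<cdot>\<^bsub>D\<^esub> comparison a"

definition id_frame :: "'o \<Rightarrow> ('o, 'p, 'b) frame" where
  "id_frame X = Frame X (Fo X) (Id D (Fo X))"

lemma is_frame_id_frame: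
  assumes "X \<in> Obj C"
  shows "is_frame (id_frame X)"
  using D.Id_Hom[OF functor_Obj[OF assms]] D.Comp_Id functor_Obj assms
  by (auto simp: is_frame_def id_frame_def)

text \<open>
  This carries equations from \<open>C\<close> to \<open>D\<close>: if two arrows of \<open>D\<close> represent the two sides of an
  equation in \<open>C\<close>, they are equal.
\<close>

lemma represents_unique:
  assumes f: "represents a b f' f" and g: "represents a b g' f"
  shows "f' = g'"
proof -
  let ?v = "comparison b"
  have v: "?v \<in> Hom D (model b) (Fo (base b))"
    and f': "f' \<in> Hom D (model a) (model b)" and g': "g' \<in> Hom D (model a) (model b)"
    and eq: "?v \<cdot>\<^bsub>D\<^esub> f' = ?v \<cdot>\<^bsub>D\<^esub> g'"
    using f g by (auto simp: represents_def is_frame_def)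
  obtain r where r: "r \<in> Hom D (Fo (base b)) (model b)" and rv: "r \<cdot>\<^bsub>D\<^esub> ?v = Id D (model b)"
    using f by (auto simp: represents_def is_frame_def)
  have "f' = r \<cdot>\<^bsub>D\<^esub> (?v \<cdot>\<^bsub>D\<^esub> f')"
    using D.Comp_assoc[OF f' v r] rv D.Id_Comp[OF f'] by simp
  also have "\<dots> = g'"
    using D.Comp_assoc[OF g' v r] rv D.Id_Comp[OF g'] eq by simp
  finally show ?thesis .
qed

lemma represents_Id:
  assumes "is_frame a"
  shows "represents a a (Id D (model a)) (Id C (base a))"
proof -
  have "comparison a \<in> Hom D (model a) (Fo (base a))"
    using assms by (simp add: is_frame_def)
  then show ?thesis
    using assms functor_Id D.Comp_Id D.Id_Comp C.Id_Hom D.Id_Hom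
    by (auto simp: represents_def is_frame_def)
qed

lemma represents_Comp:
  assumes f: "represents a b f' f" and g: "represents b c g' g"
  shows "represents a c (g' \<cdot>\<^bsub>D\<^esub> f') (g \<cdot>\<^bsub>C\<^esub> f)"
proof -
  let ?u = "comparison a" and ?v = "comparison b" and ?w = "comparison c"
  have u: "?u \<in> Hom D (model a) (Fo (base a))" and v: "?v \<in> Hom D (model b) (Fo (base b))"
    and w: "?w \<in> Hom D (model c) (Fo (base c))"
    and fC: "f \<in> Hom C (base a) (base b)" and gC: "g \<in> Hom C (base b) (base c)"
    and f': "f' \<in> Hom D (model a) (model b)" and g': "g' \<in> Hom D (model b) (model c)"
    and vf: "?v \<cdot>\<^bsub>D\<^esub> f' = Fa f \<cdot>\<^bsub>D\<^esub> ?u" and wg: "?w \<cdot>\<^bsub>D\<^esub> g' = Fa g \<cdot>\<^bsub>D\<^esub> ?v"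
    using f g by (auto simp: represents_def is_frame_def)
  have "?w \<cdot>\<^bsub>D\<^esub> (g' \<cdot>\<^bsub>D\<^esub> f') = Fa g \<cdot>\<^bsub>D\<^esub> ?v \<cdot>\<^bsub>D\<^esub> f'"
    using D.Comp_assoc[OF f' g' w] wg by simp
  also have "\<dots> = Fa g \<cdot>\<^bsub>D\<^esub> (Fa f \<cdot>\<^bsub>D\<^esub> ?u)"
    using D.Comp_assoc[OF f' v functor_Hom[OF gC]] vf by simp
  also have "\<dots> = Fa (g \<cdot>\<^bsub>C\<^esub> f) \<cdot>\<^bsub>D\<^esub> ?u"
    using D.Comp_assoc[OF u functor_Hom[OF fC] functor_Hom[OF gC]] functor_Comp[OF fC gC] by simp
  finally show ?thesis
    using f g C.Comp_Hom[OF fC gC] D.Comp_Hom[OF f' g'] by (simp add: represents_def)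
qed

end

context additive_functor
begin

lemma represents_Add:
  assumes f: "represents a b f' f" and g: "represents a b g' g"
  shows "represents a b (f' \<oplus>\<^bsub>D\<^esub> g') (f \<oplus>\<^bsub>C\<^esub> g)"
proof -
  let ?u = "comparison a" and ?v = "comparison b"
  have u: "?u \<in> Hom D (model a) (Fo (base a))" and v: "?v \<in> Hom D (model b) (Fo (base b))"
    and fC: "f \<in> Hom C (base a) (base b)" and gC: "g \<in> Hom C (base a) (base b)"
    and f': "f' \<in> Hom D (model a) (model b)" and g': "g' \<in> Hom D (model a) (model b)"
    and vf: "?v \<cdot>\<^bsub>D\<^esub> f' = Fa f \<cdot>\<^bsub>D\<^esub> ?u" and vg: "?v \<cdot>\<^bsub>D\<^esub> g' = Fa g \<cdot>\<^bsub>D\<^esub> ?u"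
    using f g by (auto simp: represents_def is_frame_def)
  have "?v \<cdot>\<^bsub>D\<^esub> (f' \<oplus>\<^bsub>D\<^esub> g') = Fa (f \<oplus>\<^bsub>C\<^esub> g) \<cdot>\<^bsub>D\<^esub> ?u"
    using D.Add_Comp[OF f' g' v] D.Comp_Add[OF u functor_Hom[OF fC] functor_Hom[OF gC]]
      functor_Add[OF fC gC] vf vg by simp
  then show ?thesis
    using f C.Add_Hom[OF fC gC] D.Add_Hom[OF f' g'] by (simp add: represents_def)
qed

lemma represents_Zero:
  assumes "is_frame a" "is_frame b"
  shows "represents a b (Zero D (model a) (model b)) (Zero C (base a) (base b))"
  using assms functor_Zero[of "base a" "base b"] C.Zero_Hom[of "base a" "base b"]
    D.Zero_Hom[of "model a" "model b"]
    D.Comp_Zero[of "comparison b" "model b" "Fo (base b)" "model a"]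
    D.Zero_Comp[of "comparison a" "model a" "Fo (base a)" "Fo (base b)"]
  by (auto simp: represents_def is_frame_def functor_Obj)

end

section \<open>Tensor products of frames\<close>

context nonunital_monoidal_functor
begin

definition tensor_frame ::
    "('o, 'p, 'b) frame \<Rightarrow> ('o, 'p, 'b) frame \<Rightarrow> ('o, 'p, 'b) frame" where
  "tensor_frame a b = Frame (base a \<odot>\<^bsub>C\<^esub> base b) (model a \<odot>\<^bsub>D\<^esub> model b)
     (\<Psi> (base a) (base b) \<cdot>\<^bsub>D\<^esub> (comparison a \<star>\<^bsub>D\<^esub> comparison b))"

text \<open>
  This is where the associativity axiom of \<open>\<Psi>\<close> enters: the threefold tensor power of a frame
  does not depend on the bracketing.
\<close>

lemma tensor_frame_assoc:
  assumes a: "is_frame a" and b: "is_frame b" and c: "is_frame c"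
  shows "tensor_frame (tensor_frame a b) c = tensor_frame a (tensor_frame b c)"
proof -
  let ?X = "base a" and ?Y = "base b" and ?Z = "base c"
  let ?u = "comparison a" and ?v = "comparison b" and ?w = "comparison c"
  have X: "?X \<in> Obj C" and Y: "?Y \<in> Obj C" and Z: "?Z \<in> Obj C"
    and u: "?u \<in> Hom D (model a) (Fo ?X)" and v: "?v \<in> Hom D (model b) (Fo ?Y)"
    and w: "?w \<in> Hom D (model c) (Fo ?Z)"
    and objs: "model a \<in> Obj D" "model b \<in> Obj D" "model c \<in> Obj D"
    using a b c by (auto simp: is_frame_def)
  note uv = D.Tensor_Hom[OF u v] and vw = D.Tensor_Hom[OF v w]
  note XY = Psi_Hom[OF X Y] and YZ = Psi_Hom[OF Y Z]
  note iX = D.Id_Hom[OF functor_Obj[OF X]] and iZ = D.Id_Hom[OF functor_Obj[OF Z]]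
  have oa: "(Fo ?X \<odot>\<^bsub>D\<^esub> Fo ?Y) \<odot>\<^bsub>D\<^esub> Fo ?Z = Fo ?X \<odot>\<^bsub>D\<^esub> (Fo ?Y \<odot>\<^bsub>D\<^esub> Fo ?Z)"
    using D.Tensor_obj_assoc X Y Z functor_Obj by blast
  have ob: "(?X \<odot>\<^bsub>C\<^esub> ?Y) \<odot>\<^bsub>C\<^esub> ?Z = ?X \<odot>\<^bsub>C\<^esub> (?Y \<odot>\<^bsub>C\<^esub> ?Z)"
    using C.Tensor_obj_assoc[OF X Y Z] .
  have aa: "?u \<star>\<^bsub>D\<^esub> ?v \<star>\<^bsub>D\<^esub> ?w = ?u \<star>\<^bsub>D\<^esub> (?v \<star>\<^bsub>D\<^esub> ?w)"
    using D.Tensor_arr_assoc u v w by (auto simp: Hom_def)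
  have PXY_Z: "\<Psi> (?X \<odot>\<^bsub>C\<^esub> ?Y) ?Z \<in>
      Hom D (Fo (?X \<odot>\<^bsub>C\<^esub> ?Y) \<odot>\<^bsub>D\<^esub> Fo ?Z) (Fo (?X \<odot>\<^bsub>C\<^esub> ?Y \<odot>\<^bsub>C\<^esub> ?Z))"
    using Psi_Hom C.Tensor_Obj X Y Z by blast
  have PX_YZ: "\<Psi> ?X (?Y \<odot>\<^bsub>C\<^esub> ?Z) \<in>
      Hom D (Fo ?X \<odot>\<^bsub>D\<^esub> Fo (?Y \<odot>\<^bsub>C\<^esub> ?Z)) (Fo (?X \<odot>\<^bsub>C\<^esub> (?Y \<odot>\<^bsub>C\<^esub> ?Z)))"
    using Psi_Hom C.Tensor_Obj X Y Z by blast
  have "\<Psi> (?X \<odot>\<^bsub>C\<^esub> ?Y) ?Z \<cdot>\<^bsub>D\<^esub> ((\<Psi> ?X ?Y \<cdot>\<^bsub>D\<^esub> (?u \<star>\<^bsub>D\<^esub> ?v)) \<star>\<^bsub>D\<^esub> ?w)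
      = \<Psi> (?X \<odot>\<^bsub>C\<^esub> ?Y) ?Z \<cdot>\<^bsub>D\<^esub> ((\<Psi> ?X ?Y \<star>\<^bsub>D\<^esub> Id D (Fo ?Z)) \<cdot>\<^bsub>D\<^esub> (?u \<star>\<^bsub>D\<^esub> ?v \<star>\<^bsub>D\<^esub> ?w))"
    using D.Tensor_Comp[OF uv XY w iZ] D.Id_Comp[OF w] by simp
  also have "\<dots> = \<Psi> (?X \<odot>\<^bsub>C\<^esub> ?Y) ?Z \<cdot>\<^bsub>D\<^esub> (\<Psi> ?X ?Y \<star>\<^bsub>D\<^esub> Id D (Fo ?Z)) \<cdot>\<^bsub>D\<^esub> (?u \<star>\<^bsub>D\<^esub> ?v \<star>\<^bsub>D\<^esub> ?w)"
    using D.Comp_assoc[OF D.Tensor_Hom[OF uv w] D.Tensor_Hom[OF XY iZ] PXY_Z] by simp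
  also have "\<dots> = \<Psi> ?X (?Y \<odot>\<^bsub>C\<^esub> ?Z) \<cdot>\<^bsub>D\<^esub> (Id D (Fo ?X) \<star>\<^bsub>D\<^esub> \<Psi> ?Y ?Z) \<cdot>\<^bsub>D\<^esub> (?u \<star>\<^bsub>D\<^esub> (?v \<star>\<^bsub>D\<^esub> ?w))"
    using Psi_assoc[OF X Y Z] aa by simp
  also have "\<dots> = \<Psi> ?X (?Y \<odot>\<^bsub>C\<^esub> ?Z) \<cdot>\<^bsub>D\<^esub> ((Id D (Fo ?X) \<star>\<^bsub>D\<^esub> \<Psi> ?Y ?Z) \<cdot>\<^bsub>D\<^esub> (?u \<star>\<^bsub>D\<^esub> (?v \<star>\<^bsub>D\<^esub> ?w)))"
    using D.Comp_assoc[OF D.Tensor_Hom[OF u vw] D.Tensor_Hom[OF iX YZ] PX_YZ] .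
  also have "\<dots> = \<Psi> ?X (?Y \<odot>\<^bsub>C\<^esub> ?Z) \<cdot>\<^bsub>D\<^esub> (?u \<star>\<^bsub>D\<^esub> (\<Psi> ?Y ?Z \<cdot>\<^bsub>D\<^esub> (?v \<star>\<^bsub>D\<^esub> ?w)))"
    using D.Tensor_Comp[OF u iX vw YZ] D.Id_Comp[OF u] by simp
  finally show ?thesis
    using ob D.Tensor_obj_assoc[OF objs] by (simp add: tensor_frame_def)
qed

lemma tensor_id_frame:
  assumes X: "X \<in> Obj C" and Y: "Y \<in> Obj C"
  shows "tensor_frame (id_frame X) (id_frame Y) = Frame (X \<odot>\<^bsub>C\<^esub> Y) (Fo X \<odot>\<^bsub>D\<^esub> Fo Y) (\<Psi> X Y)"
  using D.Tensor_Id[OF functor_Obj[OF X] functor_Obj[OF Y]] D.Comp_Id[OF Psi_Hom[OF X Y]]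
  by (simp add: tensor_frame_def id_frame_def)

end

context strong_nonunital_monoidal_functor
begin

lemma Inv_Psi:
  assumes X: "X \<in> Obj C" and Y: "Y \<in> Obj C"
  shows "Inv D (\<Psi> X Y) \<in> Hom D (Fo (X \<odot>\<^bsub>C\<^esub> Y)) (Fo X \<odot>\<^bsub>D\<^esub> Fo Y)"
    and "Inv D (\<Psi> X Y) \<cdot>\<^bsub>D\<^esub> \<Psi> X Y = Id D (Fo X \<odot>\<^bsub>D\<^esub> Fo Y)"
    and "\<Psi> X Y \<cdot>\<^bsub>D\<^esub> Inv D (\<Psi> X Y) = Id D (Fo (X \<odot>\<^bsub>C\<^esub> Y))"
  using D.is_inverse_Inv[OF Psi_invertible[OF X Y]] Psi_Hom[OF X Y]
  by (auto simp: is_inverse_def Hom_def)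

lemma is_frame_tensor_frame:
  assumes a: "is_frame a" and b: "is_frame b"
  shows "is_frame (tensor_frame a b)"
proof -
  let ?X = "base a" and ?Y = "base b" and ?u = "comparison a" and ?v = "comparison b"
  have X: "?X \<in> Obj C" and Y: "?Y \<in> Obj C" and A: "model a \<in> Obj D" and B: "model b \<in> Obj D"
    and u: "?u \<in> Hom D (model a) (Fo ?X)" and v: "?v \<in> Hom D (model b) (Fo ?Y)"
    using a b by (auto simp: is_frame_def)
  obtain r where r: "r \<in> Hom D (Fo ?X) (model a)" and ru: "r \<cdot>\<^bsub>D\<^esub> ?u = Id D (model a)"
    using a by (auto simp: is_frame_def)
  obtain s where s: "s \<in> Hom D (Fo ?Y) (model b)" and sv: "s \<cdot>\<^bsub>D\<^esub> ?v = Id D (model b)"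
    using b by (auto simp: is_frame_def)
  note P = Psi_Hom[OF X Y] and Q = Inv_Psi[OF X Y]
  note uv = D.Tensor_Hom[OF u v] and rs = D.Tensor_Hom[OF r s]
  let ?l = "(r \<star>\<^bsub>D\<^esub> s) \<cdot>\<^bsub>D\<^esub> Inv D (\<Psi> ?X ?Y)"
  have "?l \<cdot>\<^bsub>D\<^esub> (\<Psi> ?X ?Y \<cdot>\<^bsub>D\<^esub> (?u \<star>\<^bsub>D\<^esub> ?v))
      = (r \<star>\<^bsub>D\<^esub> s) \<cdot>\<^bsub>D\<^esub> (Inv D (\<Psi> ?X ?Y) \<cdot>\<^bsub>D\<^esub> \<Psi> ?X ?Y \<cdot>\<^bsub>D\<^esub> (?u \<star>\<^bsub>D\<^esub> ?v))"
    using D.Comp_assoc[OF D.Comp_Hom[OF uv P] Q(1) rs] D.Comp_assoc[OF uv P Q(1)] by simp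
  also have "\<dots> = Id D (model a \<odot>\<^bsub>D\<^esub> model b)"
    using Q(2) D.Id_Comp[OF uv] D.Tensor_Comp[OF u r v s] ru sv D.Tensor_Id[OF A B] by simp
  finally show ?thesis
    using C.Tensor_Obj[OF X Y] D.Tensor_Obj[OF A B] D.Comp_Hom[OF uv P] D.Comp_Hom[OF Q(1) rs]
    by (auto simp: is_frame_def tensor_frame_def)
qed

lemma represents_Tensor:
  assumes f: "represents a b f' f" and g: "represents c d g' g"
  shows "represents (tensor_frame a c) (tensor_frame b d) (f' \<star>\<^bsub>D\<^esub> g') (f \<star>\<^bsub>C\<^esub> g)"
proof -
  let ?u = "comparison a" and ?v = "comparison b" and ?w = "comparison c" and ?z = "comparison d"
  let ?P = "\<Psi> (base a) (base c)" and ?Q = "\<Psi> (base b) (base d)"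
  have u: "?u \<in> Hom D (model a) (Fo (base a))" and v: "?v \<in> Hom D (model b) (Fo (base b))"
    and w: "?w \<in> Hom D (model c) (Fo (base c))" and z: "?z \<in> Hom D (model d) (Fo (base d))"
    and fC: "f \<in> Hom C (base a) (base b)" and gC: "g \<in> Hom C (base c) (base d)"
    and f': "f' \<in> Hom D (model a) (model b)" and g': "g' \<in> Hom D (model c) (model d)"
    and vf: "?v \<cdot>\<^bsub>D\<^esub> f' = Fa f \<cdot>\<^bsub>D\<^esub> ?u" and zg: "?z \<cdot>\<^bsub>D\<^esub> g' = Fa g \<cdot>\<^bsub>D\<^esub> ?w"
    and fr: "is_frame a" "is_frame b" "is_frame c" "is_frame d"
    using f g by (auto simp: represents_def is_frame_def)
  have P: "?P \<in> Hom D (Fo (base a) \<odot>\<^bsub>D\<^esub> Fo (base c)) (Fo (base a \<odot>\<^bsub>C\<^esub> base c))"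
    and Q: "?Q \<in> Hom D (Fo (base b) \<odot>\<^bsub>D\<^esub> Fo (base d)) (Fo (base b \<odot>\<^bsub>C\<^esub> base d))"
    using fr Psi_Hom by (auto simp: is_frame_def)
  note Ff = functor_Hom[OF fC] and Fg = functor_Hom[OF gC]
  have "?Q \<cdot>\<^bsub>D\<^esub> (?v \<star>\<^bsub>D\<^esub> ?z) \<cdot>\<^bsub>D\<^esub> (f' \<star>\<^bsub>D\<^esub> g') = ?Q \<cdot>\<^bsub>D\<^esub> ((Fa f \<cdot>\<^bsub>D\<^esub> ?u) \<star>\<^bsub>D\<^esub> (Fa g \<cdot>\<^bsub>D\<^esub> ?w))"
    using D.Comp_assoc[OF D.Tensor_Hom[OF f' g'] D.Tensor_Hom[OF v z] Q]
      D.Tensor_Comp[OF f' v g' z] vf zg by simp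
  also have "\<dots> = ?Q \<cdot>\<^bsub>D\<^esub> (Fa f \<star>\<^bsub>D\<^esub> Fa g) \<cdot>\<^bsub>D\<^esub> (?u \<star>\<^bsub>D\<^esub> ?w)"
    using D.Comp_assoc[OF D.Tensor_Hom[OF u w] D.Tensor_Hom[OF Ff Fg] Q]
      D.Tensor_Comp[OF u Ff w Fg] by simp
  also have "\<dots> = Fa (f \<star>\<^bsub>C\<^esub> g) \<cdot>\<^bsub>D\<^esub> (?P \<cdot>\<^bsub>D\<^esub> (?u \<star>\<^bsub>D\<^esub> ?w))"
    using D.Comp_assoc[OF D.Tensor_Hom[OF u w] P functor_Hom[OF C.Tensor_Hom[OF fC gC]]]
      Psi_natural[OF fC gC] by simp
  finally have comm: "?Q \<cdot>\<^bsub>D\<^esub> (?v \<star>\<^bsub>D\<^esub> ?z) \<cdot>\<^bsub>D\<^esub> (f' \<star>\<^bsub>D\<^esub> g')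
      = Fa (f \<star>\<^bsub>C\<^esub> g) \<cdot>\<^bsub>D\<^esub> (?P \<cdot>\<^bsub>D\<^esub> (?u \<star>\<^bsub>D\<^esub> ?w))" .
  show ?thesis
    using comm is_frame_tensor_frame[OF fr(1,3)] is_frame_tensor_frame[OF fr(2,4)]
      C.Tensor_Hom[OF fC gC] D.Tensor_Hom[OF f' g']
    by (simp add: represents_def tensor_frame_def)
qed

text \<open>
  Here the inverse of \<open>\<Psi>\<close> is needed on the right: a frame, having only a left inverse, detects
  equality of representatives but does not provide them.
\<close>

lemma represents_conjugate:
  assumes X: "X \<in> Obj C" and Y: "Y \<in> Obj C" and f: "f \<in> Hom C (X \<odot>\<^bsub>C\<^esub> Y) (X \<odot>\<^bsub>C\<^esub> Y)"
  defines "a \<equiv> tensor_frame (id_frame X) (id_frame Y)"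
  shows "represents a a (Inv D (\<Psi> X Y) \<cdot>\<^bsub>D\<^esub> Fa f \<cdot>\<^bsub>D\<^esub> \<Psi> X Y) f"
proof -
  note P = Psi_Hom[OF X Y] and Q = Inv_Psi[OF X Y] and Ff = functor_Hom[OF f]
  have a: "is_frame a"
    unfolding a_def using is_frame_tensor_frame is_frame_id_frame X Y by blast
  have "\<Psi> X Y \<cdot>\<^bsub>D\<^esub> (Inv D (\<Psi> X Y) \<cdot>\<^bsub>D\<^esub> Fa f \<cdot>\<^bsub>D\<^esub> \<Psi> X Y)
      = \<Psi> X Y \<cdot>\<^bsub>D\<^esub> Inv D (\<Psi> X Y) \<cdot>\<^bsub>D\<^esub> (Fa f \<cdot>\<^bsub>D\<^esub> \<Psi> X Y)"
    using D.Comp_assoc[OF P Ff Q(1)] D.Comp_assoc[OF D.Comp_Hom[OF P Ff] Q(1) P] by simp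
  also have "\<dots> = Fa f \<cdot>\<^bsub>D\<^esub> \<Psi> X Y"
    using Q(3) D.Id_Comp[OF D.Comp_Hom[OF P Ff]] by simp
  finally show ?thesis
    using a f D.Comp_Hom[OF P D.Comp_Hom[OF Ff Q(1)]]
    by (simp add: represents_def a_def tensor_id_frame[OF X Y])
qed

lemma represents_Comp_Psi:
  assumes X: "X \<in> Obj C" and Y: "Y \<in> Obj C" and Z: "Z \<in> Obj C"
    and f: "f \<in> Hom C (X \<odot>\<^bsub>C\<^esub> Y) Z"
  shows "represents (tensor_frame (id_frame X) (id_frame Y)) (id_frame Z) (Fa f \<cdot>\<^bsub>D\<^esub> \<Psi> X Y) f"
proof -
  have a: "is_frame (tensor_frame (id_frame X) (id_frame Y))"
    using is_frame_tensor_frame is_frame_id_frame X Y by blast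
  have FfP: "Fa f \<cdot>\<^bsub>D\<^esub> \<Psi> X Y \<in> Hom D (Fo X \<odot>\<^bsub>D\<^esub> Fo Y) (Fo Z)"
    using D.Comp_Hom[OF Psi_Hom[OF X Y] functor_Hom[OF f]] .
  show ?thesis
    using a f FfP D.Id_Comp[OF FfP] is_frame_id_frame[OF Z]
    unfolding represents_def tensor_id_frame[OF X Y] by (simp add: id_frame_def)
qed

end

section \<open>Transport of YB-Lie algebras\<close>

theorem corollary3p6:
  fixes C :: "('o, 'a, 'm) addmoncat_scheme"
    and D :: "('p, 'b, 'n) addmoncat_scheme"
    and Fo :: "'o \<Rightarrow> 'p" and Fa :: "'a \<Rightarrow> 'b" and \<Psi> :: "'o \<Rightarrow> 'o \<Rightarrow> 'b"
    and L :: 'o and lam br :: 'a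
  assumes "additive_strict_monoidal_category C"
    and "additive_strict_monoidal_category D"
    and "strong_nonunital_monoidal_functor C D Fo Fa \<Psi>"
    and "additive_functor C D Fo Fa"
    and "YB_Lie_algebra C L lam br"
  shows "YB_Lie_algebra D (Fo L)
    (Inv D (\<Psi> L L) \<cdot>\<^bsub>D\<^esub> Fa lam \<cdot>\<^bsub>D\<^esub> \<Psi> L L)
    (Fa br \<cdot>\<^bsub>D\<^esub> \<Psi> L L)"
proof -
  interpret F: strong_nonunital_monoidal_functor C D Fo Fa \<Psi> by fact
  interpret A: additive_functor C D Fo Fa by fact
  interpret Y: YB_Lie_algebra C L lam br by fact
  let ?M = "Fo L"
  define l' where "l' = Inv D (\<Psi> L L) \<cdot>\<^bsub>D\<^esub> Fa lam \<cdot>\<^bsub>D\<^esub> \<Psi> L L"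
  define br' where "br' = Fa br \<cdot>\<^bsub>D\<^esub> \<Psi> L L"
  define e1 where "e1 = F.id_frame L"
  define e2 where "e2 = F.tensor_frame e1 e1"
  define e3 where "e3 = F.tensor_frame e2 e1"
  note L = Y.L_Obj
  have M: "?M \<in> Obj D"
    using F.functor_Obj[OF L] .
  have frames: "F.is_frame e1" "F.is_frame e2" "F.is_frame e3"
    using F.is_frame_id_frame[OF L] F.is_frame_tensor_frame
    by (auto simp: e1_def e2_def e3_def)
  \<comment> \<open>Tensoring with \<open>L\<close> on the right leads to the bracketing \<open>(L \<otimes> L) \<otimes> L\<close>, on the left to
      \<open>L \<otimes> (L \<otimes> L)\<close>; both have to be read in the same frame for the composites to make sense.\<close>
  have e3': "e3 = F.tensor_frame e1 e2"
    using F.tensor_frame_assoc[OF frames(1,1,1)] by (simp add: e3_def e2_def)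
  have [simp]: "base e1 = L" "model e1 = ?M"
    "base e2 = L \<odot>\<^bsub>C\<^esub> L" "model e2 = ?M \<odot>\<^bsub>D\<^esub> ?M"
    "base e3 = L \<odot>\<^bsub>C\<^esub> L \<odot>\<^bsub>C\<^esub> L" "model e3 = ?M \<odot>\<^bsub>D\<^esub> ?M \<odot>\<^bsub>D\<^esub> ?M"
    by (simp_all add: e1_def e2_def e3_def F.id_frame_def F.tensor_frame_def)
  note rC = F.represents_Comp and rA = A.represents_Add
  have id1: "F.represents e1 e1 (Id D ?M) (Id C L)"
    and id2: "F.represents e2 e2 (Id D (?M \<odot>\<^bsub>D\<^esub> ?M)) (Id C (L \<odot>\<^bsub>C\<^esub> L))"
    and id3: "F.represents e3 e3 (Id D (?M \<odot>\<^bsub>D\<^esub> ?M \<odot>\<^bsub>D\<^esub> ?M)) (Id C (L \<odot>\<^bsub>C\<^esub> L \<odot>\<^bsub>C\<^esub> L))"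
    using F.represents_Id[OF frames(1)] F.represents_Id[OF frames(2)]
      F.represents_Id[OF frames(3)] by simp_all
  have z2: "F.represents e2 e1 (Zero D (?M \<odot>\<^bsub>D\<^esub> ?M) ?M) (Zero C (L \<odot>\<^bsub>C\<^esub> L) L)"
    and z3: "F.represents e3 e1 (Zero D (?M \<odot>\<^bsub>D\<^esub> ?M \<odot>\<^bsub>D\<^esub> ?M) ?M) (Zero C (L \<odot>\<^bsub>C\<^esub> L \<odot>\<^bsub>C\<^esub> L) L)"
    using A.represents_Zero[OF frames(2,1)] A.represents_Zero[OF frames(3,1)] by simp_all
  have l: "F.represents e2 e2 l' lam"
    using F.represents_conjugate[OF L L Y.YB_Hom] by (simp add: l'_def e2_def e1_def)
  have b: "F.represents e2 e1 br' br"
    using F.represents_Comp_Psi[OF L L L Y.bracket_Hom] by (simp add: br'_def e2_def e1_def)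
  have l1: "F.represents e3 e3 (l' \<star>\<^bsub>D\<^esub> Id D ?M) (lam \<star>\<^bsub>C\<^esub> Id C L)"
    using F.represents_Tensor[OF l id1] by (simp add: e3_def)
  have l2: "F.represents e3 e3 (Id D ?M \<star>\<^bsub>D\<^esub> l') (Id C L \<star>\<^bsub>C\<^esub> lam)"
    using F.represents_Tensor[OF id1 l] by (simp add: e3')
  have b1: "F.represents e3 e2 (br' \<star>\<^bsub>D\<^esub> Id D ?M) (br \<star>\<^bsub>C\<^esub> Id C L)"
    using F.represents_Tensor[OF b id1] by (simp add: e3_def e2_def)
  have b2: "F.represents e3 e2 (Id D ?M \<star>\<^bsub>D\<^esub> br') (Id C L \<star>\<^bsub>C\<^esub> br)"
    using F.represents_Tensor[OF id1 b] by (simp add: e3' e2_def[symmetric])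
  have t: "F.represents e3 e3 (YB_t D ?M l') (YB_t C L lam)"
    unfolding YB_t_def by (rule rC[OF l2 l1])
  have w: "F.represents e3 e3 (YB_w D ?M l') (YB_w C L lam)"
    unfolding YB_w_def by (rule rC[OF l1 l2])
  interpret DA: additive_strict_monoidal_category D by fact
  have "YB_Lie_algebra D ?M l' br'"
  proof
    show "?M \<in> Obj D" by (rule M)
    show "l' \<in> Hom D (?M \<odot>\<^bsub>D\<^esub> ?M) (?M \<odot>\<^bsub>D\<^esub> ?M)"
      using l by (simp add: F.represents_def)
    show "br' \<in> Hom D (?M \<odot>\<^bsub>D\<^esub> ?M) ?M"
      using b by (simp add: F.represents_def)
    show "l' \<cdot>\<^bsub>D\<^esub> l' = Id D (?M \<odot>\<^bsub>D\<^esub> ?M)"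
      using F.represents_unique[OF rC[OF l l, unfolded Y.YB_self_inverse] id2] .
    show "(l' \<star>\<^bsub>D\<^esub> Id D ?M) \<cdot>\<^bsub>D\<^esub> (Id D ?M \<star>\<^bsub>D\<^esub> l') \<cdot>\<^bsub>D\<^esub> (l' \<star>\<^bsub>D\<^esub> Id D ?M) =
        (Id D ?M \<star>\<^bsub>D\<^esub> l') \<cdot>\<^bsub>D\<^esub> (l' \<star>\<^bsub>D\<^esub> Id D ?M) \<cdot>\<^bsub>D\<^esub> (Id D ?M \<star>\<^bsub>D\<^esub> l')"
      using F.represents_unique[OF rC[OF l1 rC[OF l2 l1], unfolded Y.YB_equation]
          rC[OF l2 rC[OF l1 l2]]] .
    show "br' \<cdot>\<^bsub>D\<^esub> (Id D (?M \<odot>\<^bsub>D\<^esub> ?M) \<oplus>\<^bsub>D\<^esub> l') = Zero D (?M \<odot>\<^bsub>D\<^esub> ?M) ?M"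
      using F.represents_unique[OF rC[OF rA[OF id2 l] b, unfolded Y.antisymmetry] z2] .
    show "br' \<cdot>\<^bsub>D\<^esub> (Id D ?M \<star>\<^bsub>D\<^esub> br') \<cdot>\<^bsub>D\<^esub>
        (Id D (?M \<odot>\<^bsub>D\<^esub> ?M \<odot>\<^bsub>D\<^esub> ?M) \<oplus>\<^bsub>D\<^esub> YB_t D ?M l' \<oplus>\<^bsub>D\<^esub> YB_w D ?M l') =
        Zero D (?M \<odot>\<^bsub>D\<^esub> ?M \<odot>\<^bsub>D\<^esub> ?M) ?M"
      using F.represents_unique[OF
          rC[OF rA[OF rA[OF id3 t] w] rC[OF b2 b], unfolded Y.Jacobi] z3] .
    show "(Id D ?M \<star>\<^bsub>D\<^esub> br') \<cdot>\<^bsub>D\<^esub> YB_t D ?M l' = l' \<cdot>\<^bsub>D\<^esub> (br' \<star>\<^bsub>D\<^esub> Id D ?M)"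
      using F.represents_unique[OF rC[OF t b2, unfolded Y.compatibility] rC[OF b1 l]] .
  qed
  then show ?thesis
    by (simp add: l'_def br'_def)
qed

end
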